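(* If $G$ is a connected graph of order $n$, then \[ \operatorname{lpt}(G)\leq \left\lceil\frac{n}{4}-\frac{n^{2/3}}{90}\right\rceil . \]
   Context: All graphs are simple, finite, and undirected; the order of a graph (or of a path) is its number of vertices. A longest path of a graph $G$ is a path in $G$ of maximum order among all paths in $G$. A longest path transversal of $G$ is a set of vertices of $G$ that intersects the vertex set of every longest path of $G$. $\operatorname{lpt}(G)$ denotes the minimum cardinality of a longest path transversal of $G$. *)

theory Defs
  imports Complex_Main "Graph_Theory.Graph_Theory"
begin

text \<open>
  Simple finite undirected graphs are the symmetric digraphs of locale \<^locale>\<open>Digraph.graph\<close>
  (finite, without loops and parallel arcs), an undirected edge being a pair of opposite arcs.
  A path is its nonempty, repetition-free list of vertices (\<^const>\<open>vpath\<close>), so its order is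
  the length of that list.
\<close>

definition longest_path :: "('a, 'b) pre_digraph \<Rightarrow> 'a list \<Rightarrow> bool" where
  "longest_path G p \<longleftrightarrow> vpath p G \<and> (\<forall>q. vpath q G \<longrightarrow> length q \<le> length p)"

definition longest_path_transversal :: "('a, 'b) pre_digraph \<Rightarrow> 'a set \<Rightarrow> bool" where
  "longest_path_transversal G S \<longleftrightarrow>
     S \<subseteq> verts G \<and> (\<forall>p. longest_path G p \<longrightarrow> S \<inter> set p \<noteq> {})"

text \<open>
  The finiteness condition is redundant for finite graphs; it excludes the
  convention that infinite sets have cardinality 0.
\<close>

definition lpt :: "('a, 'b) pre_digraph \<Rightarrow> nat" where
  "lpt G = (LEAST k. \<exists>S. longest_path_transversal G S \<and> finite S \<and> card S = k)"

lemma longest_path_transversal_verts: "longest_path_transversal G (verts G)"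
proof -
  have "verts G \<inter> set p \<noteq> {}" if "longest_path G p" for p
  proof -
    from that have "set p \<subseteq> verts G" "p \<noteq> []"
      by (auto simp: longest_path_def vpath_def vwalk_def)
    then show ?thesis by (cases p) auto
  qed
  then show ?thesis by (simp add: longest_path_transversal_def)
qed

lemma lpt_attained:
  assumes "finite (verts G)"
  obtains S where "longest_path_transversal G S" "card S = lpt G"
proof -
  have "\<exists>S. longest_path_transversal G S \<and> finite S \<and> card S = lpt G"
    unfolding lpt_def
    by (rule LeastI_ex) (use longest_path_transversal_verts assms in blast)
  then show thesis using that by blast
qed

lemma lpt_le_card:
  assumes "finite (verts G)" "longest_path_transversal G S"
  shows "lpt G \<le> card S"
proof -
  have "finite S"
    using assms finite_subset by (auto simp: longest_path_transversal_def)
  then show ?thesis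
    unfolding lpt_def using assms(2) by (intro Least_le) blast
qed

end

theory Submission
  imports Defs
begin

text \<open>
  The bound follows from the linear bound \<open>5 * lpt G \<le> n + 4\<close>: as \<open>n powr (2/3) \<le> n\<close>, it
  suffices that \<open>(n - 1) / 5\<close> is less than \<open>n / 4 - n / 90\<close>.

  Let \<open>\<ell>\<close> be the order of the longest paths and suppose \<open>lpt G \<ge> 2\<close>. A set of fewer than
  \<open>lpt G\<close> vertices misses some longest path. Apply this to the \<open>lpt G - 1\<close> vertices that
  follow the first half of a longest path \<open>P\<close>. Two longest paths of a connected graph meet, and
  no longest path can meet \<open>P\<close> only in its first or only in its last half
  (\<open>longest_path_meets_larger_part\<close>); so a longest path \<open>Q\<close> that misses the chosen vertices
  meets \<open>P\<close> on both sides of them. The stretch of \<open>P\<close> between the meeting points closest to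
  the chosen vertices is then an ear of \<open>Q\<close>: a path \<open>E\<close> disjoint from \<open>Q\<close>, of some order \<open>e \<ge> lpt G - 1\<close>, whose ends are adjacent to
  two vertices of \<open>Q\<close> (\<open>obtain_long_ear\<close>).

  A second transversal comes from this ear. Let \<open>N\<close> be the set of vertices of \<open>Q\<close> with a
  neighbour on \<open>E\<close>. Removing \<open>N\<close> and everything outside \<open>Q\<close> and \<open>E\<close> separates
  \<open>E\<close> from the rest of \<open>Q\<close>, and neither side is large enough for a longest path; hence
  \<open>lpt G \<le> (n - \<ell> - e) + card N\<close> (\<open>lpt_le_off_ear\<close>).

  The set \<open>N\<close> is small because \<open>Q\<close> cannot be lengthened by a detour through \<open>E\<close>: if two
  vertices of \<open>Q\<close> are adjacent to the vertices with indices \<open>i\<close> and \<open>j\<close> of \<open>E\<close>, then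
  more than \<open>\<bar>i - j\<bar>\<close> vertices of \<open>Q\<close> lie between them, and similarly the ends of \<open>Q\<close> are far
  away. Since the ends of \<open>E\<close> are attached to \<open>Q\<close> as well, this gives
  \<open>3 * e + 2 \<le> \<ell>\<close> (\<open>ear_length_bound\<close>) and
  \<open>2 * card N + 3 * e \<le> \<ell> + 2\<close> (\<open>ear_attachments_bound\<close>). Eliminating \<open>\<ell>\<close>, \<open>e\<close> and
  \<open>card N\<close> from these inequalities leaves \<open>5 * lpt G \<le> n + 4\<close>.
\<close>

section \<open>Two combinatorial facts\<close>

text \<open>
  The values of \<open>u\<close> and their successors are pairwise distinct, so there are \<open>2 * card N\<close> of
  them, all in an interval only one longer than the given one. The case \<open>lo = hi + 2\<close> is
  admitted because an interval that is empty in this way still satisfies the inequality.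
\<close>

lemma two_separated_card_le:
  fixes N :: "nat set" and u :: "nat \<Rightarrow> nat"
  assumes "finite N" "u ` N \<subseteq> {lo..hi}" "lo \<le> hi + 2"
    and sep: "\<And>p q. p \<in> N \<Longrightarrow> q \<in> N \<Longrightarrow> p < q \<Longrightarrow> u p + 2 \<le> u q"
  shows "2 * card N + lo \<le> hi + 2"
proof -
  have diff: "u p \<noteq> u q \<and> u p \<noteq> Suc (u q)" if "p \<in> N" "q \<in> N" "p \<noteq> q" for p q
    using sep[of p q] sep[of q p] that by (cases p q rule: linorder_cases) simp_all
  have "inj_on u N"
    using diff by (meson inj_onI)
  moreover from this have "inj_on (Suc \<circ> u) N"
    by (simp add: comp_inj_on)
  moreover have "u ` N \<inter> (Suc \<circ> u) ` N = {}"
  proof -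
    have "u p \<noteq> Suc (u q)" if "p \<in> N" "q \<in> N" for p q
      using diff[OF that] by (cases "p = q") auto
    then show ?thesis by auto
  qed
  ultimately have "2 * card N = card (u ` N \<union> (Suc \<circ> u) ` N)"
    using assms(1) by (metis card_Un_disjoint card_image finite_imageI mult_2)
  also have "\<dots> \<le> card {lo..hi + 1}"
    using assms(2) by (intro card_mono) (auto simp: subset_iff)
  finally show ?thesis using assms(3) by simp
qed

lemma successively_subset_cases:
  assumes "successively P xs" "set xs \<subseteq> X \<union> Y"
    and "\<And>x y. x \<in> X \<Longrightarrow> y \<in> Y \<Longrightarrow> \<not> P x y \<and> \<not> P y x"
  shows "set xs \<subseteq> X \<or> set xs \<subseteq> Y"
  using assms(1,2)
proof (induction xs)
  case (Cons x xs)
  show ?case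
  proof (cases "xs = []")
    case False
    then have "P x (hd xs)" "hd xs \<in> set xs"
      using Cons.prems by (auto simp: successively_Cons)
    moreover have "set xs \<subseteq> X \<or> set xs \<subseteq> Y"
      using Cons by (auto simp: successively_Cons)
    ultimately show ?thesis
      using Cons.prems(2) assms(3)[of x "hd xs"] assms(3)[of "hd xs" x] by auto
  qed (use Cons.prems in auto)
qed simp

section \<open>Detours from a longest path\<close>

context graph
begin

lemma vpath_iff_successively:
  "vpath p G \<longleftrightarrow> p \<noteq> [] \<and> set p \<subseteq> verts G \<and> distinct p \<and> successively (\<lambda>u v. u \<rightarrow>\<^bsub>G\<^esub> v) p"
proof -
  have "vwalk p G \<longleftrightarrow> p \<noteq> [] \<and> set p \<subseteq> verts G \<and> successively (\<lambda>u v. u \<rightarrow>\<^bsub>G\<^esub> v) p" for p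
  proof (induction p rule: induct_list012)
    case (3 u v p)
    then show ?case
      by (auto simp del: vwalk_Cons_Cons simp add: vwalk_def)
  qed (auto simp: vwalk_def)
  then show ?thesis
    by (auto simp: vpath_def)
qed

lemma successively_adj_rev [simp]:
  "successively (\<lambda>u v. v \<rightarrow>\<^bsub>G\<^esub> u) p \<longleftrightarrow> successively (\<lambda>u v. u \<rightarrow>\<^bsub>G\<^esub> v) p"
  using graph_symmetric by (intro successively_cong) auto

lemma vpath_rev [simp]: "vpath (rev p) G \<longleftrightarrow> vpath p G"
  by (auto simp: vpath_iff_successively)

lemma longest_path_rev [simp]: "longest_path G (rev p) \<longleftrightarrow> longest_path G p"
  by (simp add: longest_path_def)

lemma longest_path_vpathD: "longest_path G p \<Longrightarrow> vpath p G"
  by (simp add: longest_path_def)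

lemma longest_path_length_eq:
  "longest_path G p \<Longrightarrow> longest_path G q \<Longrightarrow> length p = length q"
  by (meson longest_path_def order_antisym)

text \<open>
  Replacing the stretch \<open>B\<close> of the longest path by \<open>F\<close> gives another path.
\<close>

lemma longest_path_detour:
  assumes "longest_path G (A @ u # B @ v # C)" "vpath F G"
    and "set F \<inter> set (A @ u # B @ v # C) = {}" "u \<rightarrow>\<^bsub>G\<^esub> hd F" "v \<rightarrow>\<^bsub>G\<^esub> last F"
  shows "length F \<le> length B"
proof -
  have "F \<noteq> []" "last F \<rightarrow>\<^bsub>G\<^esub> v"
    using assms(2,5) graph_symmetric by (simp_all add: vpath_iff_successively)
  moreover have "vpath (A @ u # B @ v # C) G"
    using assms(1) by (rule longest_path_vpathD)
  ultimately have "vpath (A @ u # F @ v # C) G"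
    using assms(2-4) unfolding vpath_iff_successively
    by (simp add: successively_append_iff successively_Cons Int_Un_distrib) blast
  then have "length (A @ u # F @ v # C) \<le> length (A @ u # B @ v # C)"
    using assms(1) by (auto simp: longest_path_def)
  then show ?thesis by simp
qed

text \<open>
  Leaving the longest path at \<open>u\<close> and continuing along \<open>F\<close> gives another path, and either of
  the two parts of the longest path at \<open>u\<close> may be given up for it.
\<close>

lemma longest_path_tail:
  assumes "longest_path G (A @ u # B)" "vpath F G"
    and "set F \<inter> set (A @ u # B) = {}" "u \<rightarrow>\<^bsub>G\<^esub> hd F"
  shows "length F \<le> length A" "length F \<le> length B"
proof -
  have *: "length F \<le> length B" if "longest_path G (A @ u # B)" "set F \<inter> set (A @ u # B) = {}" for A B
  proof -
    have "vpath (A @ u # B) G"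
      using that(1) by (rule longest_path_vpathD)
    then have "vpath (A @ u # F) G"
      using that(2) assms(2,4) unfolding vpath_iff_successively
      by (simp add: successively_append_iff successively_Cons Int_Un_distrib) blast
    then have "length (A @ u # F) \<le> length (A @ u # B)"
      using that by (auto simp: longest_path_def)
    then show ?thesis by simp
  qed
  show "length F \<le> length B"
    using * assms by blast
  have "longest_path G (rev B @ u # rev A)"
    using assms(1) longest_path_rev[of "A @ u # B"] by (simp del: longest_path_rev)
  then show "length F \<le> length A"
    using *[of "rev B" "rev A"] assms by auto
qed

lemma vpath_append_leftD: "vpath (A @ B) G \<Longrightarrow> A \<noteq> [] \<Longrightarrow> vpath A G"
  and vpath_append_rightD: "vpath (A @ B) G \<Longrightarrow> B \<noteq> [] \<Longrightarrow> vpath B G"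
  by (auto simp: vpath_iff_successively successively_append_iff)

text \<open>
  The length is written as \<open>(i - j) + (j - i) + 1\<close> because at least one of the two truncated
  differences is 0, so that their sum is \<open>\<bar>i - j\<bar>\<close>.
\<close>

lemma vpath_between:
  assumes "vpath E G" "i < length E" "j < length E"
  obtains F where "vpath F G" "set F \<subseteq> set E" "hd F = E ! i" "last F = E ! j"
    "length F = (i - j) + (j - i) + 1"
proof -
  have main: "\<exists>F. vpath F G \<and> set F \<subseteq> set E \<and> hd F = E ! i \<and> last F = E ! j \<and> length F = j - i + 1"
    if "i \<le> j" "j < length E" for i j
  proof -
    define F where "F = drop i (take (Suc j) E)"
    have "take (Suc j) E = take i E @ F"
      using that unfolding F_def by (metis append_take_drop_id le_SucI min.absorb1 take_take)
    then have E: "E = take i E @ F @ drop (Suc j) E"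
      by (metis append.assoc append_take_drop_id)
    have len: "length F = j - i + 1"
      using that by (simp add: F_def Suc_diff_le)
    then have "F \<noteq> []" by auto
    have "vpath (F @ drop (Suc j) E) G"
      by (rule vpath_append_rightD[of "take i E"]) (use assms(1) E[symmetric] \<open>F \<noteq> []\<close> in auto)
    then have "vpath F G"
      using vpath_append_leftD \<open>F \<noteq> []\<close> by blast
    moreover have "set F \<subseteq> set E"
      using F_def by (meson in_set_dropD in_set_takeD subsetI)
    moreover have "hd F = E ! i" "last F = E ! j"
      using that len \<open>F \<noteq> []\<close> by (auto simp: hd_conv_nth last_conv_nth F_def)
    ultimately show ?thesis using len by blast
  qed
  show thesis
  proof (cases "i \<le> j")
    case True
    then show thesis using main[of i j] assms that by auto
  next
    case False
    then obtain F where "vpath F G" "set F \<subseteq> set E" "hd F = E ! j" "last F = E ! i"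
        "length F = i - j + 1"
      using main[of j i] assms by auto
    then show thesis
      using False that[of "rev F"] by (auto simp: hd_rev last_rev vpath_iff_successively)
  qed
qed

text \<open>
  From \<open>Q ! p\<close> one can enter \<open>E\<close> at index \<open>i\<close> and follow \<open>E\<close> to either end; this adds
  \<open>i + 1\<close> or \<open>length E - i\<close> vertices, and both parts of \<open>Q\<close> at \<open>Q ! p\<close> are at least that long.
\<close>

lemma attachment_end_distance:
  assumes "longest_path G Q" "vpath E G" "set E \<inter> set Q = {}"
    and "p < length Q" "i < length E" "Q ! p \<rightarrow>\<^bsub>G\<^esub> E ! i"
  shows "i < p" "length E \<le> p + i" "p + i + 2 \<le> length Q" "p + length E + 1 \<le> length Q + i"
proof -
  have Q: "take p Q @ Q ! p # drop (Suc p) Q = Q"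
    using assms(4) by (simp add: id_take_nth_drop[symmetric])
  have *: "(i - j) + (j - i) + 1 \<le> p \<and> (i - j) + (j - i) + 1 \<le> length Q - Suc p"
    if j: "j < length E" for j
  proof -
    obtain F where F: "vpath F G" "set F \<subseteq> set E" "hd F = E ! i"
        "length F = (i - j) + (j - i) + 1"
      using vpath_between[OF assms(2,5) j] by metis
    have "longest_path G (take p Q @ Q ! p # drop (Suc p) Q)"
      "set F \<inter> set (take p Q @ Q ! p # drop (Suc p) Q) = {}"
      using assms(1,3) F(2) unfolding Q by auto
    from longest_path_tail[OF this(1) F(1) this(2)] F assms(4,6) show ?thesis
      by simp
  qed
  show "i < p" "length E \<le> p + i" "p + i + 2 \<le> length Q" "p + length E + 1 \<le> length Q + i"
    using *[of 0] *[of "length E - 1"] assms(4,5) by linarith+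
qed

text \<open>
  The detour from \<open>Q ! p\<close> to \<open>Q ! p'\<close> through \<open>E\<close> has \<open>\<bar>i - j\<bar> + 1\<close> inner vertices, so the
  stretch of \<open>Q\<close> that it replaces has at least as many. The two conclusions together say
  \<open>p + \<bar>i - j\<bar> + 2 \<le> p'\<close>; linear inequalities over the naturals are easier to combine.
\<close>

lemma attachment_gap:
  assumes "longest_path G Q" "vpath E G" "set E \<inter> set Q = {}"
    and "p < p'" "p' < length Q" "i < length E" "j < length E"
    and "Q ! p \<rightarrow>\<^bsub>G\<^esub> E ! i" "Q ! p' \<rightarrow>\<^bsub>G\<^esub> E ! j"
  shows "p + i + 2 \<le> p' + j" "p + j + 2 \<le> p' + i"
proof -
  obtain F where F: "vpath F G" "set F \<subseteq> set E" "hd F = E ! i" "last F = E ! j"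
      "length F = (i - j) + (j - i) + 1"
    using vpath_between[OF assms(2,6,7)] by metis
  define B where "B = drop (Suc p) (take p' Q)"
  have Q: "take p Q @ Q ! p # B @ Q ! p' # drop (Suc p') Q = Q"
  proof -
    have "take p' Q = take p (take p' Q) @ take p' Q ! p # drop (Suc p) (take p' Q)"
      using assms by (intro id_take_nth_drop) simp
    then have split: "take p' Q = take p Q @ Q ! p # B"
      using assms(4) by (simp add: B_def)
    have "take p' Q @ Q ! p' # drop (Suc p') Q = Q"
      using assms by (simp add: id_take_nth_drop[symmetric])
    then show ?thesis
      by (simp add: split)
  qed
  have "length F \<le> length B"
    using longest_path_detour[of "take p Q" "Q ! p" B "Q ! p'" "drop (Suc p') Q" F]
      Q assms F by auto
  then show "p + i + 2 \<le> p' + j" "p + j + 2 \<le> p' + i"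
    using F(5) assms(4,5) by (auto simp: B_def)
qed

section \<open>Ears of a longest path\<close>

text \<open>
  The ends of the ear cut \<open>Q\<close> into three parts, each of which could be exchanged for the whole
  ear: the middle part by a detour, the outer parts by a tail.
\<close>

lemma ear_length_bound:
  assumes "longest_path G Q" "vpath E G" "set E \<inter> set Q = {}"
    and "a < b" "b < length Q" "Q ! a \<rightarrow>\<^bsub>G\<^esub> hd E" "Q ! b \<rightarrow>\<^bsub>G\<^esub> last E"
  shows "3 * length E + 2 \<le> length Q"
proof -
  define e where "e = length E - 1"
  have "E \<noteq> []"
    using assms(2) by (simp add: vpath_iff_successively)
  then have E: "length E = Suc e" "hd E = E ! 0" "last E = E ! e"
    by (simp_all add: e_def hd_conv_nth last_conv_nth)
  have a: "length E \<le> a"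
    using attachment_end_distance(2)[OF assms(1-3), of a 0] assms(4-7) E by simp
  have b: "b + e + 2 \<le> length Q"
    using attachment_end_distance(3)[OF assms(1-3), of b e] assms(4-7) E by simp
  have "a + e + 2 \<le> b"
    using attachment_gap(2)[OF assms(1-5), of 0 e] assms(4-7) E by simp
  with a b E show ?thesis by simp
qed

text \<open>
  Choose for each attachment \<open>p \<in> N\<close> an index \<open>f p\<close> of a neighbour on the ear. Any two
  attachments \<open>p < q\<close> satisfy \<open>p + \<bar>f p - f q\<bar> + 2 \<le> q\<close>, so each of the shifted
  positions \<open>p + f p\<close> and \<open>p - f p\<close> still increases by at least 2 from one attachment to the
  next. The shift \<open>u\<close> uses the sign \<open>+\<close> on the two outer parts of \<open>Q\<close> and the sign \<open>-\<close>
  between the ends of the ear. With \<open>f a = 0\<close>, \<open>f b = length E - 1\<close> and a translation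
  of the last part, the formulas agree at \<open>a\<close> and at \<open>b\<close>. These signs squeeze the values of \<open>u\<close>
  into an interval shorter than \<open>Q\<close> by about \<open>3 * length E\<close>: a part as long as the ear is
  saved at either end of \<open>Q\<close> and one more between \<open>a\<close> and \<open>b\<close>.
\<close>

lemma ear_attachments_bound:
  assumes "longest_path G Q" "vpath E G" "set E \<inter> set Q = {}"
    and "a < b" "b < length Q" "Q ! a \<rightarrow>\<^bsub>G\<^esub> hd E" "Q ! b \<rightarrow>\<^bsub>G\<^esub> last E"
  defines "N \<equiv> {p. p < length Q \<and> (\<exists>v\<in>set E. Q ! p \<rightarrow>\<^bsub>G\<^esub> v)}"
  shows "2 * card N + 3 * length E \<le> length Q + 2"
proof -
  define e where "e = length E - 1"
  have "E \<noteq> []"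
    using assms(2) by (simp add: vpath_iff_successively)
  then have E: "length E = Suc e" "hd E = E ! 0" "last E = E ! e"
    by (simp_all add: e_def hd_conv_nth last_conv_nth)
  have "\<exists>i. i < length E \<and> Q ! p \<rightarrow>\<^bsub>G\<^esub> E ! i" if "p \<in> N" for p
    using that by (auto simp: N_def in_set_conv_nth)
  then obtain g where g: "\<And>p. p \<in> N \<Longrightarrow> g p < length E \<and> Q ! p \<rightarrow>\<^bsub>G\<^esub> E ! g p"
    by metis
  \<comment> \<open>The ends of the ear are attached at a and b; f has to select these two edges there.\<close>
  define f where "f = g(a := 0, b := e)"
  have f: "f p < length E" "Q ! p \<rightarrow>\<^bsub>G\<^esub> E ! f p" if "p \<in> N" for p
    using g[OF that] assms(4-7) E by (auto simp: f_def)
  have fa: "f a = 0" and fb: "f b = e"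
    using assms(4) by (auto simp: f_def)
  have aN: "a \<in> N" and bN: "b \<in> N"
    using assms(4-7) \<open>E \<noteq> []\<close> by (auto simp: N_def)
  have gap: "p + f p + 2 \<le> q + f q" "p + f q + 2 \<le> q + f p" if "p \<in> N" "q \<in> N" "p < q" for p q
    using attachment_gap[OF assms(1-3) that(3), of "f p" "f q"] f that by (auto simp: N_def)
  have ends: "length E \<le> p + f p" "p + f p + 2 \<le> length Q" if "p \<in> N" for p
    using attachment_end_distance[OF assms(1-3), of p "f p"] f[OF that] that by (auto simp: N_def)
  have ab: "e < a" "a + e + 2 \<le> b" "b + e + 2 \<le> length Q"
    using ends[OF aN] gap[OF aN bN assms(4)] ends[OF bN] E fa fb by auto
  have after_a: "a + f p + 2 \<le> p" if "p \<in> N" "a < p" for p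
    using gap[OF aN that(1)] that fa by auto
  have before_b: "p + e + 2 \<le> b + f p" if "p \<in> N" "p < b" for p
    using gap[OF that(1) bN] that fb by auto
  have after_b: "b + e + 2 \<le> p + f p" if "p \<in> N" "b < p" for p
    using gap[OF bN that(1)] that fb by auto
  define u where "u p = (if p \<le> a then p + f p else if p \<le> b then p - f p else p + f p - 2 * e)" for p
  have left: "u p = p + f p" if "p \<le> a" for p
    using that by (simp add: u_def)
  have middle: "u p + f p = p" "a \<le> u p" "u p + e \<le> b" if "p \<in> N" "a \<le> p" "p \<le> b" for p
  proof -
    have "a + f p \<le> p"
      using after_a[of p] that fa by (cases "p = a") auto
    moreover have "p + e \<le> b + f p"
      using before_b[of p] that fb by (cases "p = b") auto
    moreover have "u p + f p = p"
      using \<open>a + f p \<le> p\<close> that fa by (auto simp: u_def)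
    ultimately show "u p + f p = p" "a \<le> u p" "u p + e \<le> b" by linarith+
  qed
  have right: "u p + 2 * e = p + f p" if "p \<in> N" "b \<le> p" for p
    using after_b[of p] that fb ab assms(4) by (cases "p = b") (auto simp: u_def)
  have sep: "u p + 2 \<le> u q" if pq: "p \<in> N" "q \<in> N" "p < q" and side: "q \<le> a \<or> a \<le> p \<and> q \<le> b \<or> b \<le> p" for p q
    using side
  proof (elim disjE conjE)
    assume "q \<le> a"
    then show ?thesis using gap(1)[OF pq] left[of p] left[of q] pq(3) by simp
  next
    assume "a \<le> p" "q \<le> b"
    then show ?thesis using gap(2)[OF pq] middle(1)[of p] middle(1)[of q] pq by simp
  next
    assume "b \<le> p"
    then show ?thesis using gap(1)[OF pq] right[of p] right[of q] pq by simp
  qed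
  have "2 * card N + length E \<le> (length Q - 2 - 2 * e) + 2"
  proof (rule two_separated_card_le)
    show "finite N" by (simp add: N_def)
    show "length E \<le> length Q - 2 - 2 * e + 2"
      using ab E by simp
    show "u ` N \<subseteq> {length E..length Q - 2 - 2 * e}"
    proof
      fix v assume "v \<in> u ` N"
      then obtain p where p: "p \<in> N" "v = u p" by blast
      have "e + 1 \<le> u p \<and> u p + 2 + 2 * e \<le> length Q"
      proof -
        consider "p < a" | "a \<le> p" "p \<le> b" | "b < p" by linarith
        then show ?thesis
        proof cases
          case 1
          then show ?thesis
            using left[of p] ends(1)[OF p(1)] gap(1)[OF p(1) aN 1] ab E(1) fa by simp
        next
          case 2
          then show ?thesis using middle[OF p(1)] ab by simp
        next
          case 3
          then show ?thesis
            using right[OF p(1)] after_b[OF p(1)] ends(2)[OF p(1)] ab by simp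
        qed
      qed
      then show "v \<in> {length E..length Q - 2 - 2 * e}"
        using p(2) E(1) by auto
    qed
    fix p q assume pq: "p \<in> N" "q \<in> N" "p < q"
    \<comment> \<open>If p and q lie in different parts of Q, pass through a or b, where both formulas for u are valid.\<close>
    consider "q \<le> a \<or> a \<le> p \<and> q \<le> b \<or> b \<le> p" | "p < a" "a < q" "q \<le> b"
      | "p < a" "b < q" | "a \<le> p" "p < b" "b < q"
      by linarith
    then show "u p + 2 \<le> u q"
    proof cases
      case 1
      with pq show ?thesis by (rule sep)
    next
      case 2
      then show ?thesis
        using sep[OF pq(1) aN] sep[OF aN pq(2)] by simp
    next
      case 3
      then show ?thesis
        using sep[OF pq(1) aN] sep[OF aN bN assms(4)] sep[OF bN pq(2)] assms(4) by simp
    next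
      case 4
      then show ?thesis
        using sep[OF pq(1) bN] sep[OF bN pq(2)] by simp
    qed
  qed
  with ab E show ?thesis by simp
qed

text \<open>
  Deleting the vertices outside \<open>Q\<close> and \<open>E\<close> and those of \<open>Q\<close> that are attached to \<open>E\<close>
  leaves no edge between \<open>E\<close> and the rest of \<open>Q\<close>. A longest path that avoids all deleted
  vertices would therefore lie within \<open>E\<close> or within a proper subset of \<open>Q\<close>, but both have
  fewer vertices than \<open>Q\<close>.
\<close>

lemma lpt_le_off_ear:
  assumes "longest_path G Q" "vpath E G" "set E \<inter> set Q = {}" "length E < length Q"
    and "N = {p. p < length Q \<and> (\<exists>v\<in>set E. Q ! p \<rightarrow>\<^bsub>G\<^esub> v)}" "N \<noteq> {}"
  shows "lpt G + length Q + length E \<le> card (verts G) + card N"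
proof -
  define D where "D = verts G - (set Q \<union> set E)"
  define M where "M = (\<lambda>p. Q ! p) ` N"
  have Q: "set Q \<subseteq> verts G" "distinct Q" and E: "set E \<subseteq> verts G" "distinct E"
    using assms(1,2) by (auto simp: longest_path_def vpath_iff_successively)
  have M: "M \<subseteq> set Q" "M \<noteq> {}"
    using assms(5,6) by (auto simp: M_def)
  have no_edge: "\<not> x \<rightarrow>\<^bsub>G\<^esub> y \<and> \<not> y \<rightarrow>\<^bsub>G\<^esub> x" if xy: "x \<in> set E" "y \<in> set Q - M" for x y
  proof -
    have "\<not> y \<rightarrow>\<^bsub>G\<^esub> x"
    proof
      assume adj: "y \<rightarrow>\<^bsub>G\<^esub> x"
      obtain p where p: "p < length Q" "y = Q ! p"
        using xy(2) by (auto simp: in_set_conv_nth)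
      then have "p \<in> N"
        using adj xy(1) assms(5) by auto
      then show False
        using p xy(2) by (auto simp: M_def)
    qed
    then show ?thesis using graph_symmetric by blast
  qed
  have "longest_path_transversal G (D \<union> M)"
    unfolding longest_path_transversal_def
  proof (intro conjI allI impI notI)
    show "D \<union> M \<subseteq> verts G"
      using M Q by (auto simp: D_def)
    fix T assume T: "longest_path G T" "(D \<union> M) \<inter> set T = {}"
    have vT: "vpath T G" using T(1) by (rule longest_path_vpathD)
    then have dT: "length T = card (set T)" "set T \<subseteq> set E \<union> (set Q - M)"
      using T(2) by (auto simp: vpath_iff_successively distinct_card D_def)
    have len: "length T = length Q"
      using T(1) assms(1) by (rule longest_path_length_eq)
    from dT(2) have "set T \<subseteq> set E \<or> set T \<subseteq> set Q - M"
      using vT no_edge unfolding vpath_iff_successively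
      by (intro successively_subset_cases[where P = "\<lambda>u v. u \<rightarrow>\<^bsub>G\<^esub> v"]) auto
    then show False
    proof
      assume "set T \<subseteq> set E"
      then have "length T \<le> length E"
        using dT(1) E(2) by (metis List.finite_set card_mono distinct_card)
      then show False using len assms(4) by simp
    next
      assume "set T \<subseteq> set Q - M"
      then have "set T \<subset> set Q" using M by blast
      then have "length T < length Q"
        using dT(1) Q(2) by (metis List.finite_set psubset_card_mono distinct_card)
      then show False using len by simp
    qed
  qed
  then have "lpt G \<le> card (D \<union> M)"
    by (intro lpt_le_card) auto
  also have "\<dots> \<le> card D + card N"
  proof -
    have "finite N" using assms(5) by simp
    then show ?thesis
      using card_Un_le[of D M] card_image_le[of N "\<lambda>p. Q ! p"] by (simp add: M_def)
  qed
  finally have "lpt G \<le> card D + card N" .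
  moreover have "card D + (length Q + length E) = card (verts G)"
  proof -
    have "length Q + length E = card (set Q \<union> set E)"
      using Q E assms(3) by (simp add: card_Un_disjoint distinct_card Int_commute)
    then show ?thesis
      unfolding D_def using Q E
      by (metis card_Diff_subset card_mono finite_verts finite_subset le_add_diff_inverse2 Un_least)
  qed
  ultimately show ?thesis by simp
qed

section \<open>Longest paths in a connected graph\<close>

lemma reachable_if_connected:
  assumes "connected G" "u \<in> verts G" "v \<in> verts G"
  shows "u \<rightarrow>\<^sup>*\<^bsub>G\<^esub> v"
  using assms reachable_mk_symmetric_eq[OF sym_arcs]
  by (auto simp: connected_def strongly_connected_def)

text \<open>
  If two longest paths were disjoint, join them by a path that touches them only with its ends.
  From the second path one could then cross to the first one and follow the longer of its two
  parts; this tail would have more than half of the order of a longest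
  path, and one part of the second path is shorter than that.
\<close>

lemma longest_paths_intersect:
  assumes "connected G" "longest_path G P" "longest_path G Q"
  shows "set P \<inter> set Q \<noteq> {}"
proof
  assume disj: "set P \<inter> set Q = {}"
  have P: "vpath P G" and Q: "vpath Q G"
    using assms by (auto simp: longest_path_def)
  then have "hd P \<rightarrow>\<^sup>*\<^bsub>G\<^esub> hd Q"
    by (intro reachable_if_connected[OF assms(1)]) (auto simp: vpath_iff_successively)
  then obtain R where R: "vpath R G" "hd R = hd P" "last R = hd Q"
    by (auto simp: reachable_vpath_conv)
  have "R \<noteq> []" "P \<noteq> []" "Q \<noteq> []"
    using R(1) P Q by (simp_all add: vpath_iff_successively)
  then have ends: "hd R \<in> set R" "last R \<in> set R" "hd R \<in> set P" "last R \<in> set Q"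
    by (simp, simp, simp add: R(2), simp add: R(3))
  then obtain R1 u R2 where u: "R = R1 @ u # R2" "u \<in> set P" "\<forall>z\<in>set R2. z \<notin> set P"
    using split_list_last_prop[of R "\<lambda>z. z \<in> set P"] by blast
  then have "last R \<in> set R2"
    using ends(4) disj by (auto split: if_splits)
  then obtain F v R3 where v: "R2 = F @ v # R3" "v \<in> set Q" "\<forall>z\<in>set F. z \<notin> set Q"
    using split_list_first_prop[of R2 "\<lambda>z. z \<in> set Q"] ends(4) by blast
  have "vpath (R1 @ (u # F @ [v]) @ R3) G"
    using R(1) by (simp add: u(1) v(1))
  then have "vpath (u # F @ [v]) G"
    using vpath_append_leftD vpath_append_rightD by blast
  then have link: "vpath (v # rev F @ [u]) G"
    using vpath_rev[of "u # F @ [v]"] by simp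
  obtain C D where CD: "Q = C @ v # D"
    using v(2) split_list by metis
  \<comment> \<open>Reversing P if necessary, the part of P behind u is the longer one.\<close>
  have False if AB: "longest_path G (A @ u # B)" "set (A @ u # B) = set P" "length A \<le> length B" for A B
  proof -
    define T where "T = rev F @ u # B"
    have "vpath (A @ u # B) G"
      using AB(1) by (rule longest_path_vpathD)
    moreover have "set F \<inter> set P = {}"
      using u(3) v(1) by auto
    ultimately have "vpath T G"
      using link unfolding T_def vpath_iff_successively AB(2)[symmetric]
      by (auto simp: successively_append_iff successively_Cons)
    moreover have "v \<rightarrow>\<^bsub>G\<^esub> hd T"
      using link by (cases "rev F") (auto simp: T_def vpath_iff_successively)
    moreover have "set T \<inter> set (C @ v # D) = {}"
      using v(3) disj AB(2) unfolding T_def CD[symmetric] by auto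
    ultimately have "length T \<le> length C" "length T \<le> length D"
      using longest_path_tail[of C v D T] assms(3) CD by auto
    moreover have "length (A @ u # B) = length Q"
      using AB(1) assms(3) by (rule longest_path_length_eq)
    ultimately show False
      using AB(3) by (simp add: CD T_def)
  qed note no_half = this
  obtain A B where AB: "P = A @ u # B"
    using u(2) split_list by metis
  then have "longest_path G (rev B @ u # rev A)"
    using assms(2) longest_path_rev[of "A @ u # B"] by (simp del: longest_path_rev)
  then show False
    using no_half[of A B] no_half[of "rev B" "rev A"] assms(2) AB
    by (cases "length A \<le> length B") auto
qed

text \<open>
  Otherwise \<open>Q\<close> meets the first path within \<open>A\<close>. At the last vertex \<open>x\<close> of \<open>A\<close> that
  lies on \<open>Q\<close>, one can leave \<open>Q\<close> along the rest of the first path, which contains \<open>B\<close>. Both parts of \<open>Q\<close> at \<open>x\<close>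
  would be at least as long as \<open>B\<close>, hence \<open>Q\<close> longer than \<open>A @ B\<close>.
\<close>

lemma longest_path_meets_larger_part:
  assumes "connected G" "longest_path G (A @ B)" "longest_path G Q" "length A \<le> length B"
  shows "set B \<inter> set Q \<noteq> {}"
proof
  assume disj: "set B \<inter> set Q = {}"
  then have "set A \<inter> set Q \<noteq> {}"
    using longest_paths_intersect[OF assms(1-3)] by auto
  then obtain A1 x A2 where x: "A = A1 @ x # A2" "x \<in> set Q" "\<forall>z\<in>set A2. z \<notin> set Q"
    using split_list_last_prop[of A "\<lambda>z. z \<in> set Q"] by blast
  obtain C D where CD: "Q = C @ x # D"
    using x(2) split_list by metis
  have "B \<noteq> []"
    using assms(4) x(1) by auto
  have "vpath (A @ B) G"
    using assms(2) by (rule longest_path_vpathD)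
  then have "vpath (A2 @ B) G" "x \<rightarrow>\<^bsub>G\<^esub> hd (A2 @ B)"
    using \<open>B \<noteq> []\<close> unfolding x(1) vpath_iff_successively
    by (auto simp: successively_append_iff successively_Cons)
  moreover have "set (A2 @ B) \<inter> set (C @ x # D) = {}"
    using x(3) disj unfolding CD[symmetric] by auto
  ultimately have "length (A2 @ B) \<le> length C" "length (A2 @ B) \<le> length D"
    using longest_path_tail[of C x D "A2 @ B"] assms(3) CD by auto
  moreover have "length (A @ B) = length Q"
    using assms(2,3) by (rule longest_path_length_eq)
  ultimately show False
    using assms(4) by (simp add: x(1) CD)
qed

text \<open>
  Fewer than \<open>lpt G\<close> vertices \<open>W\<close> just behind the first half of a longest path \<open>P\<close> are missed
  by a longest path \<open>Q\<close>. Both \<open>W\<close> with the part behind it, and \<open>W\<close> with the part before it,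
  make up at least half of \<open>P\<close>, so \<open>Q\<close> meets \<open>P\<close> on both sides of \<open>W\<close>. The ear is the
  stretch of \<open>P\<close> between the meeting points closest to \<open>W\<close>.
\<close>

lemma obtain_long_ear:
  assumes "connected G" "2 \<le> lpt G"
  obtains Q E a b where "longest_path G Q" "vpath E G" "set E \<inter> set Q = {}"
    "a < b" "b < length Q" "Q ! a \<rightarrow>\<^bsub>G\<^esub> hd E" "Q ! b \<rightarrow>\<^bsub>G\<^esub> last E" "lpt G \<le> length E + 1"
proof -
  have not_transversal: "\<exists>Q. longest_path G Q \<and> S \<inter> set Q = {}"
    if "S \<subseteq> verts G" "card S < lpt G" for S
    using lpt_le_card[of G S] that by (auto simp: longest_path_transversal_def)
  obtain P where P: "longest_path G P"
    using not_transversal[of "{}"] assms(2) by auto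
  have vP: "vpath P G"
    using P by (rule longest_path_vpathD)
  define w where "w = lpt G - 1"
  define A where "A = take (length P div 2) P"
  define W where "W = take w (drop (length P div 2) P)"
  define B where "B = drop w (drop (length P div 2) P)"
  have split: "P = A @ W @ B"
    by (simp add: A_def W_def B_def del: drop_drop)
  have w: "1 \<le> w" using assms(2) by (simp add: w_def)
  then have parts: "length A \<le> length (W @ B)" "length (rev B) \<le> length (rev (A @ W))"
    by (auto simp: A_def W_def B_def)
  have "card (set W) < lpt G"
    using card_length[of W] assms(2) by (simp add: W_def w_def del: set_take_subset) linarith
  moreover have "set W \<subseteq> verts G"
    using vP unfolding W_def vpath_iff_successively by (meson in_set_dropD in_set_takeD subset_iff)
  ultimately obtain Q where Q: "longest_path G Q" "set W \<inter> set Q = {}"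
    using not_transversal by blast
  have "set (W @ B) \<inter> set Q \<noteq> {}"
    using P Q(1) parts(1) assms(1) unfolding split by (intro longest_path_meets_larger_part)
  then have BQ: "set B \<inter> set Q \<noteq> {}"
    using Q(2) by auto
  have "set (rev (A @ W)) \<inter> set Q \<noteq> {}"
  proof (rule longest_path_meets_larger_part[OF assms(1) _ Q(1)])
    have "longest_path G (rev (A @ W @ B))"
      using P by (simp only: longest_path_rev split[symmetric])
    then show "longest_path G (rev B @ rev (A @ W))"
      by simp
  qed (fact parts(2))
  then have AQ: "set A \<inter> set Q \<noteq> {}"
    using Q(2) by auto
  obtain A1 x A2 where x: "A = A1 @ x # A2" "x \<in> set Q" "\<forall>z\<in>set A2. z \<notin> set Q"
    using AQ split_list_last_prop[of A "\<lambda>z. z \<in> set Q"] by blast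
  obtain B1 y B2 where y: "B = B1 @ y # B2" "y \<in> set Q" "\<forall>z\<in>set B1. z \<notin> set Q"
    using BQ split_list_first_prop[of B "\<lambda>z. z \<in> set Q"] by blast
  define E where "E = A2 @ W @ B1"
  have "length W = w"
  proof -
    have "B \<noteq> []" using y(1) by simp
    then show ?thesis by (simp add: W_def B_def)
  qed
  then have len: "w \<le> length E" "E \<noteq> []"
    using w by (auto simp: E_def)
  have whole: "vpath (A1 @ x # E @ y # B2) G"
    using vP[unfolded split x(1) y(1)] by (simp add: E_def)
  then have E: "vpath E G" "x \<rightarrow>\<^bsub>G\<^esub> hd E" "last E \<rightarrow>\<^bsub>G\<^esub> y" "x \<noteq> y"
    using len(2) unfolding vpath_iff_successively
    by (auto simp: successively_append_iff successively_Cons)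
  have disj: "set E \<inter> set Q = {}"
    using Q(2) x(3) y(3) by (auto simp: E_def)
  obtain a b where ab: "a < length Q" "Q ! a = x" "b < length Q" "Q ! b = y"
    using x(2) y(2) by (auto simp: in_set_conv_nth)
  have "a \<noteq> b" using ab E(4) by auto
  have lpt: "lpt G \<le> length E + 1" using len by (simp add: w_def)
  have y_adj: "y \<rightarrow>\<^bsub>G\<^esub> last E" using E(3) graph_symmetric by blast
  \<comment> \<open>The two meeting points may appear on Q in either order; reversing the ear exchanges them.\<close>
  show thesis
  proof (cases "a < b")
    case True
    then show thesis
      using that[of Q E a b] Q(1) E y_adj disj ab lpt by blast
  next
    case False
    then show thesis
      using that[of Q "rev E" b a] Q(1) E y_adj disj ab lpt \<open>a \<noteq> b\<close>
      by (simp add: hd_rev last_rev len(2))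
  qed
qed

text \<open>
  With \<open>\<ell>\<close> the order of a longest path and \<open>e\<close> the order of a long ear, the bounds combine to
  \<open>2 * lpt G \<le> 2 * n - \<ell> - 5 * e + 2 \<le> 2 * n - 8 * e\<close>, and \<open>e \<ge> lpt G - 1\<close>.
\<close>

theorem lpt_le_fifth:
  assumes "connected G"
  shows "5 * lpt G \<le> card (verts G) + 4"
proof (cases "2 \<le> lpt G")
  case False
  moreover have "verts G \<noteq> {}"
    using assms by (auto simp: connected_def strongly_connected_def)
  then have "1 \<le> card (verts G)"
    by (simp add: Suc_le_eq card_gt_0_iff)
  ultimately show ?thesis by simp
next
  case True
  obtain Q E a b where QE: "longest_path G Q" "vpath E G" "set E \<inter> set Q = {}"
      "a < b" "b < length Q" "Q ! a \<rightarrow>\<^bsub>G\<^esub> hd E" "Q ! b \<rightarrow>\<^bsub>G\<^esub> last E"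
    and lpt: "lpt G \<le> length E + 1"
    using obtain_long_ear[OF assms True] .
  define N where "N = {p. p < length Q \<and> (\<exists>v\<in>set E. Q ! p \<rightarrow>\<^bsub>G\<^esub> v)}"
  have "E \<noteq> []"
    using QE(2) by (simp add: vpath_iff_successively)
  then have "a \<in> N"
    using QE(4-6) by (auto simp: N_def)
  have long: "3 * length E + 2 \<le> length Q"
    by (rule ear_length_bound[OF QE])
  have "2 * card N + 3 * length E \<le> length Q + 2"
    unfolding N_def by (rule ear_attachments_bound[OF QE])
  moreover have "lpt G + length Q + length E \<le> card (verts G) + card N"
    using long \<open>a \<in> N\<close> by (intro lpt_le_off_ear[OF QE(1-3) _ N_def]) auto
  ultimately show ?thesis
    using long lpt by linarith
qed

end

theorem theorem2:
  fixes G :: "('a, 'b) pre_digraph" and n :: nat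
  assumes "Digraph.graph G"
    and "Digraph_Component.connected G"
    and "card (verts G) = n"
  shows "int (lpt G) \<le> \<lceil>real n / 4 - real n powr (2/3) / 90\<rceil>"
proof -
  interpret graph G by fact
  have "verts G \<noteq> {}"
    using assms(2) by (auto simp: connected_def strongly_connected_def)
  then have n: "1 \<le> real n"
    using assms(3) card_gt_0_iff[of "verts G"] by auto
  have "5 * real (lpt G) \<le> real n + 4"
    using lpt_le_fifth[OF assms(2)] assms(3) by linarith
  moreover have "real n powr (2/3) \<le> real n"
    using powr_mono[of "2/3" 1 "real n"] n by simp
  ultimately have "real (lpt G) - 1 < real n / 4 - real n powr (2/3) / 90"
    using n by linarith
  then show ?thesis
    by (simp add: le_ceiling_iff)
qed

end
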